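(* For all positive integers $q$ and $r$, the winding permutation $3$--hypergraph $W_{q,r}$ satisfies $\omega(W_{q,r})=q$.
   Context: A cyclic permutation of $\{1,\dots,n\}$ is a class $[\phi]$ of bijections $\phi:\{1,\dots,n\}\to\{1,\dots,n\}$ modulo cyclic rotation ($\phi\sim\psi$ iff there is $k$ with $\phi(i)=\psi(i+k)$ for all $i$, indices mod $n$). Elements $i<j<k$ are in clockwise order with respect to $[\phi]$ if some $\psi\in[\phi]$ has $\psi^{-1}(i)<\psi^{-1}(j)<\psi^{-1}(k)$. The $3$--hypergraph associated to $[\phi]$ has vertex set $\{1,\dots,n\}$ and edges the triples $\{i,j,k\}$, $i<j<k$, in clockwise order with respect to $[\phi]$. For positive integers $q,r$, let $n=r(q-1)+1$ and define $\phi_{q,r}:\{1,\dots,n\}\to\{1,\dots,n\}$ by $\phi_{q,r}(n)=1$ and, for $1\le i<n$ with $i\equiv j \pmod r$, $1\le j\le r$, $\phi_{q,r}(i)=2+(q-1)(r-j)+\frac{i-j}{r}$. $W_{q,r}$ is the $3$--hypergraph associated to $[\phi_{q,r}]$ (e.g. for $q=5,r=3$ the permutation is $(10\,6\,2\,11\,7\,3\,12\,8\,4\,13\,9\,5\,1)$). The clique number $\omega(H)$ of a $3$--hypergraph is the largest size of a vertex subset all of whose $3$-subsets are edges. *)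

theory Defs
  imports "HOL-Combinatorics.Permutations" "HOL-Number_Theory.Cong"
begin

(* The index i + k, read modulo n with representatives 1, ..., n. *)
definition shift_index :: "nat \<Rightarrow> nat \<Rightarrow> nat \<Rightarrow> nat" where
  "shift_index n k i = Suc ((i - 1 + k) mod n)"

definition rotation_rel :: "nat \<Rightarrow> ((nat \<Rightarrow> nat) \<times> (nat \<Rightarrow> nat)) set" where
  "rotation_rel n = {(\<phi>, \<psi>). \<phi> permutes {1..n} \<and> \<psi> permutes {1..n} \<and>
     (\<exists>k. \<forall>i\<in>{1..n}. \<phi> i = \<psi> (shift_index n k i))}"

lemma shift_index_add:
  assumes "n > 0"
  shows "shift_index n k (shift_index n l i) = shift_index n (l + k) i"
  using assms by (simp add: shift_index_def mod_add_left_eq add.assoc)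

lemma shift_index_in: "i \<in> {1..n} \<Longrightarrow> shift_index n k i \<in> {1..n}"
  by (auto simp: shift_index_def Suc_le_eq)

lemma shift_index_multiple: "i \<in> {1..n} \<Longrightarrow> shift_index n (n * k) i = i"
  by (cases i) (auto simp: shift_index_def)

lemma equiv_rotation_rel: "equiv {\<phi>. \<phi> permutes {1..n}} (rotation_rel n)"
proof (rule equivI)
  show "rotation_rel n \<subseteq> {\<phi>. \<phi> permutes {1..n}} \<times> {\<phi>. \<phi> permutes {1..n}}"
    by (auto simp: rotation_rel_def)
  show "refl_on {\<phi>. \<phi> permutes {1..n}} (rotation_rel n)"
    using shift_index_multiple[of _ n 0]
    by (auto simp: refl_on_def rotation_rel_def intro!: exI[of _ 0])
  show "sym (rotation_rel n)"
  proof (rule symI)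
    fix \<phi> \<psi> assume "(\<phi>, \<psi>) \<in> rotation_rel n"
    then obtain k where p: "\<phi> permutes {1..n}" "\<psi> permutes {1..n}"
      and k: "\<And>i. i \<in> {1..n} \<Longrightarrow> \<phi> i = \<psi> (shift_index n k i)"
      unfolding rotation_rel_def by blast
    have "\<psi> i = \<phi> (shift_index n (n * k - k) i)" if i: "i \<in> {1..n}" for i
    proof -
      from i have n: "n > 0" by auto
      hence "n * k - k + k = n * k" by simp
      thus ?thesis
        using k[OF shift_index_in[OF i]] shift_index_add[OF n] shift_index_multiple[OF i] by simp
    qed
    with p show "(\<psi>, \<phi>) \<in> rotation_rel n" unfolding rotation_rel_def by blast
  qed
  show "trans (rotation_rel n)"
  proof (rule transI)
    fix \<phi> \<psi> \<chi> assume "(\<phi>, \<psi>) \<in> rotation_rel n" "(\<psi>, \<chi>) \<in> rotation_rel n"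
    then obtain k l where p: "\<phi> permutes {1..n}" "\<chi> permutes {1..n}"
      and k: "\<And>i. i \<in> {1..n} \<Longrightarrow> \<phi> i = \<psi> (shift_index n k i)"
      and l: "\<And>i. i \<in> {1..n} \<Longrightarrow> \<psi> i = \<chi> (shift_index n l i)"
      unfolding rotation_rel_def by blast
    have "\<phi> i = \<chi> (shift_index n (k + l) i)" if i: "i \<in> {1..n}" for i
    proof -
      from i have n: "n > 0" by auto
      show ?thesis
        using k[OF i] l[OF shift_index_in[OF i]] shift_index_add[OF n] by simp
    qed
    with p show "(\<phi>, \<chi>) \<in> rotation_rel n" unfolding rotation_rel_def by blast
  qed
qed

definition cyclic_perm :: "nat \<Rightarrow> (nat \<Rightarrow> nat) \<Rightarrow> (nat \<Rightarrow> nat) set" where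
  "cyclic_perm n \<phi> = rotation_rel n `` {\<phi>}"

definition clockwise :: "(nat \<Rightarrow> nat) set \<Rightarrow> nat \<Rightarrow> nat \<Rightarrow> nat \<Rightarrow> bool" where
  "clockwise C i j k \<longleftrightarrow> (\<exists>\<psi>\<in>C. inv \<psi> i < inv \<psi> j \<and> inv \<psi> j < inv \<psi> k)"

(* A 3-hypergraph is a pair (vertex set, set of 3-element edges). *)
type_synonym 'a hypergraph3 = "'a set \<times> 'a set set"

definition perm_hypergraph :: "nat \<Rightarrow> (nat \<Rightarrow> nat) set \<Rightarrow> nat hypergraph3" where
  "perm_hypergraph n C =
     ({1..n}, {{i, j, k} | i j k. {i, j, k} \<subseteq> {1..n} \<and> i < j \<and> j < k \<and> clockwise C i j k})"

definition is_clique3 :: "'a hypergraph3 \<Rightarrow> 'a set \<Rightarrow> bool" where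
  "is_clique3 H S \<longleftrightarrow> S \<subseteq> fst H \<and> (\<forall>T. T \<subseteq> S \<and> card T = 3 \<longrightarrow> T \<in> snd H)"

(* Meaningful for finite vertex sets only. *)
definition clique_number :: "'a hypergraph3 \<Rightarrow> nat" where
  "clique_number H = Max {card S | S. is_clique3 H S}"

definition winding_size :: "nat \<Rightarrow> nat \<Rightarrow> nat" where
  "winding_size q r = r * (q - 1) + 1"

(* Here j is the representative of i modulo r in {1..r}. Outside {1..n} the
   function is the identity, as required by the predicate permutes. *)
definition winding_perm :: "nat \<Rightarrow> nat \<Rightarrow> nat \<Rightarrow> nat" where
  "winding_perm q r i =
     (if i \<notin> {1..winding_size q r} then i
      else if i = winding_size q r then 1
      else (let j = (i - 1) mod r + 1 in 2 + (q - 1) * (r - j) + (i - j) div r))"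

lemma winding_perm_size: "winding_perm q r (winding_size q r) = 1"
  by (simp add: winding_perm_def winding_size_def)

lemma winding_perm_eq:
  assumes "1 \<le> i" "i < winding_size q r" "[i = j] (mod r)" "1 \<le> j" "j \<le> r"
  shows "winding_perm q r i = 2 + (q - 1) * (r - j) + (i - j) div r"
proof -
  have "[i - 1 = j - 1] (mod r)"
    using cong_diff_nat[OF assms(3) cong_refl, of 1] assms by simp
  hence "(i - 1) mod r + 1 = j"
    using assms by (simp add: cong_def)
  thus ?thesis using assms by (simp add: winding_perm_def Let_def)
qed

lemma winding_perm_permutes:
  assumes "q \<ge> 1" "r \<ge> 1"
  shows "winding_perm q r permutes {1..winding_size q r}"
proof -
  let ?n = "winding_size q r" and ?f = "winding_perm q r"
  have form: "?f i = 2 + (q - 1) * (r - 1 - (i - 1) mod r) + (i - 1) div r"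
    and lt: "(i - 1) div r < q - 1" if "1 \<le> i" "i < ?n" for i
  proof -
    have "i - ((i - 1) mod r + 1) = (i - 1) div r * r"
      using minus_mod_eq_div_mult[of "i - 1" r] by simp
    thus "?f i = 2 + (q - 1) * (r - 1 - (i - 1) mod r) + (i - 1) div r"
      using that assms by (simp add: winding_perm_def Let_def)
    show "(i - 1) div r < q - 1"
      using that assms by (intro less_mult_imp_div_less) (auto simp: winding_size_def mult.commute)
  qed
  have range: "2 \<le> ?f i \<and> ?f i \<le> ?n" if "1 \<le> i" "i < ?n" for i
  proof -
    have "(q - 1) * (r - 1 - (i - 1) mod r) \<le> (q - 1) * (r - 1)"
      by (intro mult_le_mono) auto
    moreover have "(q - 1) * (r - 1) + (q - 1) = r * (q - 1)"
      using assms by (cases r) (auto simp: algebra_simps)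
    ultimately show ?thesis using form[OF that] lt[OF that]
      unfolding winding_size_def by linarith
  qed
  have inj_lt: "i = i'" if i: "1 \<le> i" "i < ?n" "1 \<le> i'" "i' < ?n" and eq: "?f i = ?f i'" for i i'
  proof -
    from eq have e: "(i - 1) div r + (q - 1) * (r - 1 - (i - 1) mod r)
        = (i' - 1) div r + (q - 1) * (r - 1 - (i' - 1) mod r)"
      using form[OF i(1,2)] form[OF i(3,4)] by simp
    have d: "(i - 1) div r = (i' - 1) div r"
      using arg_cong[OF e, of "\<lambda>x. x mod (q - 1)"] lt[OF i(1,2)] lt[OF i(3,4)] by simp
    have "r - 1 - (i - 1) mod r = r - 1 - (i' - 1) mod r"
      using e d lt[OF i(1,2)] by auto
    moreover have "(i - 1) mod r < r" "(i' - 1) mod r < r" using assms by auto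
    ultimately have "(i - 1) mod r = (i' - 1) mod r" by linarith
    with d have "i - 1 = i' - 1" by (metis div_mult_mod_eq)
    with i show ?thesis by simp
  qed
  have "inj_on ?f {1..?n}"
  proof (rule inj_onI)
    fix i i' assume i: "i \<in> {1..?n}" "i' \<in> {1..?n}" "?f i = ?f i'"
    consider "i = ?n" "i' = ?n" | "i < ?n" "i' = ?n" | "i = ?n" "i' < ?n" | "i < ?n" "i' < ?n"
      using i by force
    thus "i = i'"
      using i range[of i] range[of i'] inj_lt winding_perm_size[of q r] by cases auto
  qed
  moreover have "?f ` {1..?n} \<subseteq> {1..?n}"
  proof
    fix y assume "y \<in> ?f ` {1..?n}"
    then obtain i where i: "1 \<le> i" "i \<le> ?n" "y = ?f i" by auto
    show "y \<in> {1..?n}"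
    proof (cases "i = ?n")
      case True
      thus ?thesis using i winding_perm_size[of q r] by (simp add: winding_size_def)
    next
      case False
      thus ?thesis using i range[of i] by auto
    qed
  qed
  ultimately have "bij_betw ?f {1..?n} {1..?n}"
    by (simp add: bij_betw_def endo_inj_surj)
  thus ?thesis by (rule bij_imp_permutes) (auto simp: winding_perm_def)
qed

definition winding_hypergraph :: "nat \<Rightarrow> nat \<Rightarrow> nat hypergraph3" where
  "winding_hypergraph q r =
     perm_hypergraph (winding_size q r) (cyclic_perm (winding_size q r) (winding_perm q r))"

end

theory Submission
  imports Defs
begin

text \<open>
  Put \<open>n = r (q - 1) + 1\<close>. The element \<open>v\<close> sits at position \<open>r (v - 1)\<close> modulo \<open>n\<close>, so the
  permutation winds around the circle in steps of \<open>r\<close>. Let \<open>m\<close> be the least element of a clique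
  and, for a member \<open>v\<close>, let \<open>d = v - m\<close> and \<open>f = r d mod n\<close>, the clockwise distance from \<open>m\<close>
  to \<open>v\<close>. Since \<open>(q - 1) r + 1 = n\<close>, the number \<open>d + (q - 1) f\<close> is a multiple \<open>c n\<close> of \<open>n\<close>,
  and it is less than \<open>q n\<close>. Both \<open>d\<close> and \<open>f\<close> increase strictly along the clique, hence so
  does \<open>c\<close>, which takes at most \<open>q\<close> values. The set \<open>{1..q}\<close> attains the bound.
\<close>

text \<open>The residue of \<open>a + d\<close> is the sum of the two residues, reduced by
  \<open>n\<close> on wrapping around. A wrapped sum falls below \<open>a mod n\<close>, so the
  hypothesis excludes this.\<close>

lemma mod_less_mod_addD:
  fixes a d n :: nat
  assumes "a mod n < (a + d) mod n"
  shows "d mod n = (a + d) mod n - a mod n"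
proof (cases "n = 0")
  case False
  then have n: "n > 0" by simp
  have *: "(a + d) mod n = (a mod n + d mod n) mod n" by (simp add: mod_add_eq)
  show ?thesis
  proof (cases "a mod n + d mod n < n")
    case True
    then show ?thesis using * by simp
  next
    case False
    have lt: "a mod n < n" "d mod n < n" using n by auto
    have "(a mod n + d mod n) mod n = (a mod n + d mod n - n) mod n"
      using False by (intro le_mod_geq) simp
    also have "\<dots> = a mod n + d mod n - n" using lt False by (intro mod_less) linarith
    finally show ?thesis using * assms lt by linarith
  qed
qed simp

text \<open>This turns the explicit formula into arithmetic: position and value determine each other
  through multiplication by \<open>r\<close> modulo \<open>n\<close>. Away from the last index,
  writing \<open>i = r * b + j\<close> makes the two sides differ by the multiple
  \<open>n * (r - j)\<close>.\<close>

lemma winding_perm_mod: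
  assumes "i \<in> {1..winding_size q r}" "q \<ge> 1" "r \<ge> 1"
  shows "r * (winding_perm q r i - 1) mod winding_size q r = i mod winding_size q r"
proof (cases "i = winding_size q r")
  case True
  then show ?thesis by (simp add: winding_perm_size)
next
  case False
  let ?n = "winding_size q r"
  define j where "j = (i - 1) mod r + 1"
  define b where "b = (i - 1) div r"
  have i: "i = r * b + j"
    using assms mult_div_mod_eq[of r "i - 1"] by (simp add: j_def b_def)
  have j: "1 \<le> j" "j \<le> r" using assms by (auto simp: j_def Suc_le_eq)
  have "[i = j] (mod r)" by (simp add: i cong_def)
  then have "winding_perm q r i = 2 + (q - 1) * (r - j) + (i - j) div r"
    using assms False j by (intro winding_perm_eq) auto
  then have "winding_perm q r i - 1 = 1 + (q - 1) * (r - j) + b"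
    using assms i by simp
  moreover have "r * (1 + (q - 1) * (r - j) + b) = ?n * (r - j) + i"
  proof -
    \<comment> \<open>The variables \<open>p\<close> and \<open>d\<close> stand for
      \<open>q - 1\<close> and \<open>r - j\<close>, which keeps truncated subtraction out of the
      ring identity.\<close>
    have "r * (1 + p * d + b) = (r * p + 1) * d + (r * b + j)" if "r = d + j" for p d
      using that by (simp add: algebra_simps)
    from this[of "r - j" "q - 1"] show ?thesis using j by (simp add: winding_size_def i)
  qed
  ultimately show ?thesis by simp
qed

lemma inv_rotation:
  assumes "(\<phi>, \<psi>) \<in> rotation_rel n" "\<And>i. i \<in> {1..n} \<Longrightarrow> \<phi> i = \<psi> (shift_index n k i)"
    and "v \<in> {1..n}"
  shows "inv \<psi> v = shift_index n k (inv \<phi> v)"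
proof -
  have p: "\<phi> permutes {1..n}" "\<psi> permutes {1..n}"
    using assms(1) by (auto simp: rotation_rel_def)
  have "inv \<phi> v \<in> {1..n}"
    using permutes_inv[OF p(1)] permutes_in_image assms(3) by metis
  then show ?thesis
    using assms(2) permutes_inverses[OF p(1)] permutes_inverses[OF p(2)] by metis
qed

text \<open>Combined with \<open>inv_rotation\<close>, this gives all positions in a rotated
  representative. The summand \<open>n - 1\<close> plays the role of \<open>-1\<close> modulo
  \<open>n\<close>, matching the \<open>i - 1\<close> inside \<open>shift_index\<close>.\<close>

lemma shift_inv_winding_perm:
  assumes "v \<in> {1..winding_size q r}" "q \<ge> 1" "r \<ge> 1"
  shows "shift_index (winding_size q r) k (inv (winding_perm q r) v) =
    Suc ((r * (v - 1) + (winding_size q r - 1 + k)) mod winding_size q r)"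
proof -
  let ?n = "winding_size q r" and ?i = "inv (winding_perm q r) v"
  note p = winding_perm_permutes[OF assms(2,3)]
  have i: "?i \<in> {1..?n}"
    using permutes_inv[OF p] permutes_in_image assms(1) by metis
  have "winding_perm q r ?i = v" using permutes_inverses(1)[OF p] .
  then have "?i mod ?n = r * (v - 1) mod ?n"
    using winding_perm_mod[OF i assms(2,3)] by simp
  then have "(r * (v - 1) + (?n - 1 + k)) mod ?n = (?i + (?n - 1 + k)) mod ?n"
    by (metis mod_add_left_eq)
  also have "?i + (?n - 1 + k) = ?i - 1 + k + ?n" using i by auto
  finally show ?thesis by (simp add: shift_index_def)
qed

text \<open>Measured from \<open>i\<close>, the unknown rotation cancels: since \<open>i\<close>
  comes first in the representative, differences of positions are clockwise distances from
  \<open>i\<close>.\<close>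

lemma clockwise_windingD:
  assumes "clockwise (cyclic_perm (winding_size q r) (winding_perm q r)) i j k"
    and "1 \<le> i" "i < j" "j < k" "k \<le> winding_size q r" "q \<ge> 1" "r \<ge> 1"
  shows "r * (j - i) mod winding_size q r < r * (k - i) mod winding_size q r"
proof -
  let ?n = "winding_size q r"
  obtain \<psi> where rel: "(winding_perm q r, \<psi>) \<in> rotation_rel ?n"
    and lt: "inv \<psi> i < inv \<psi> j" "inv \<psi> j < inv \<psi> k"
    using assms(1) by (auto simp: clockwise_def cyclic_perm_def)
  then obtain s where s: "\<And>i. i \<in> {1..?n} \<Longrightarrow> winding_perm q r i = \<psi> (shift_index ?n s i)"
    by (auto simp: rotation_rel_def)
  define K where "K = ?n - 1 + s"
  have pos: "inv \<psi> v = Suc ((r * (v - 1) + K) mod ?n)" if "v \<in> {1..?n}" for v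
    using inv_rotation[OF rel s that] shift_inv_winding_perm[OF that assms(6,7)]
    by (simp add: K_def)
  define a where "a = r * (i - 1) + K"
  have split: "r * (v - 1) + K = a + r * (v - i)" if "i \<le> v" for v
  proof -
    have "v - 1 = (i - 1) + (v - i)" using that assms(2) by simp
    then show ?thesis by (simp add: a_def distrib_left)
  qed
  have pos': "inv \<psi> v = Suc ((a + r * (v - i)) mod ?n)" if "i \<le> v" "v \<le> ?n" for v
    using pos[of v] split[of v] that assms(2) by simp
  have "a mod ?n < (a + r * (j - i)) mod ?n"
    "(a + r * (j - i)) mod ?n < (a + r * (k - i)) mod ?n"
    using lt assms(2-5) by (simp_all add: pos')
  then show "r * (j - i) mod ?n < r * (k - i) mod ?n"
    using mod_less_mod_addD[of a ?n "r * (j - i)"] mod_less_mod_addD[of a ?n "r * (k - i)"]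
    by linarith
qed

text \<open>An edge only provides some increasing listing of the same set, but a three-element set
  has just one.\<close>

lemma clique_edgeD:
  assumes "is_clique3 (perm_hypergraph n C) S" "i \<in> S" "j \<in> S" "k \<in> S" "i < j" "j < k"
  shows "clockwise C i j k"
proof -
  have "card {i, j, k} = 3" using assms by simp
  then have "{i, j, k} \<in> snd (perm_hypergraph n C)"
    using assms unfolding is_clique3_def by simp
  then obtain a b c where abc: "{i, j, k} = {a, b, c}" "a < b" "b < c" "clockwise C a b c"
    by (auto simp: perm_hypergraph_def)
  then have "i \<in> {a, b, c}" "j \<in> {a, b, c}" "k \<in> {a, b, c}" by blast+
  then have "i = a" "j = b" "k = c" using abc(2,3) assms(5,6) by auto
  with abc show ?thesis by simp
qed

lemma is_clique3_perm_hypergraphI: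
  assumes "S \<subseteq> {1..n}"
    and "\<And>i j k. i \<in> S \<Longrightarrow> j \<in> S \<Longrightarrow> k \<in> S \<Longrightarrow> i < j \<Longrightarrow> j < k \<Longrightarrow> clockwise C i j k"
  shows "is_clique3 (perm_hypergraph n C) S"
  unfolding is_clique3_def
proof (intro conjI allI impI)
  show "S \<subseteq> fst (perm_hypergraph n C)" using assms by (simp add: perm_hypergraph_def)
  fix T assume T: "T \<subseteq> S \<and> card T = 3"
  have fin: "finite T" using T by (intro card_ge_0_finite) simp
  define l where "l = sorted_list_of_set T"
  have l: "length l = 3" "sorted_wrt (<) l" "set l = T"
    using T fin by (auto simp: l_def)
  then obtain i j k where "l = [i, j, k]"
    by (auto simp: length_Suc_conv numeral_3_eq_3)
  then have ijk: "T = {i, j, k}" "i < j" "j < k" using l by auto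
  then have "clockwise C i j k" using assms(2) T by auto
  moreover have "{i, j, k} \<subseteq> {1..n}" using ijk T assms(1) by auto
  ultimately show "T \<in> snd (perm_hypergraph n C)"
    using ijk by (auto simp: perm_hypergraph_def)
qed

lemma winding_clique_card_le:
  assumes "is_clique3 (winding_hypergraph q r) S" "q \<ge> 1" "r \<ge> 1"
  shows "card S \<le> q"
proof (cases "S = {}")
  case False
  let ?n = "winding_size q r"
  have sub: "S \<subseteq> {1..?n}"
    using assms(1) by (simp add: is_clique3_def winding_hypergraph_def perm_hypergraph_def)
  then have fin: "finite S" using finite_subset by blast
  define m where "m = Min S"
  have m: "m \<in> S" "\<And>v. v \<in> S \<Longrightarrow> m \<le> v" using fin False by (auto simp: m_def)
  define f where "f v = r * (v - m) mod ?n" for v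
  define g where "g v = v - m + (q - 1) * f v" for v
  have g_dvd: "?n dvd g v" for v
  proof -
    have "g v mod ?n = (v - m + (q - 1) * (r * (v - m))) mod ?n"
      unfolding g_def f_def by (metis mod_add_right_eq mod_mult_right_eq)
    \<comment> \<open>This is \<open>1 + (q - 1) * r = n\<close>, multiplied by
      \<open>v - m\<close>.\<close>
    also have "v - m + (q - 1) * (r * (v - m)) = ?n * (v - m)"
      by (simp add: winding_size_def)
    finally show ?thesis by (simp add: dvd_eq_mod_eq_0)
  qed
  have g_less: "g v < q * ?n" if "v \<in> S" for v
  proof -
    have "v \<le> ?n" "1 \<le> m" using sub that m(1) by auto
    then have "v - m < ?n" by (simp add: winding_size_def)
    moreover have "(q - 1) * f v \<le> (q - 1) * ?n"
      by (intro mult_le_mono) (auto simp: f_def winding_size_def)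
    ultimately have "g v < ?n + (q - 1) * ?n" unfolding g_def by linarith
    also have "\<dots> = q * ?n" using assms(2) by (cases q) auto
    finally show ?thesis .
  qed
  have g_mono: "g v < g w" if vw: "v \<in> S" "w \<in> S" "v < w" for v w
  proof -
    \<comment> \<open>Weak monotonicity suffices, as \<open>v - m\<close> makes \<open>g\<close>
      strict. The case \<open>v = m\<close> is separate because a clockwise triple needs three
      distinct elements; there \<open>f v = 0\<close>.\<close>
    have "f v \<le> f w"
    proof (cases "v = m")
      case True
      then show ?thesis by (simp add: f_def)
    next
      case False
      with m(2)[OF vw(1)] have "m < v" by simp
      then have "clockwise (cyclic_perm ?n (winding_perm q r)) m v w"
        using clique_edgeD assms(1) m(1) vw unfolding winding_hypergraph_def by blast
      then have "f v < f w" unfolding f_def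
        using clockwise_windingD \<open>m < v\<close> vw sub m(1) assms(2,3) by (auto simp: subset_iff)
      then show ?thesis by simp
    qed
    then have "(q - 1) * f v \<le> (q - 1) * f w" by (rule mult_le_mono2)
    moreover have "v - m < w - m" using vw m(2) by (simp add: diff_less_mono)
    ultimately show ?thesis unfolding g_def by linarith
  qed
  have "inj_on (\<lambda>v. g v div ?n) S"
  proof (rule inj_onI)
    fix v w assume "v \<in> S" "w \<in> S" "g v div ?n = g w div ?n"
    then have "g v = g w" using g_dvd by (metis dvd_div_mult_self)
    then show "v = w" using g_mono \<open>v \<in> S\<close> \<open>w \<in> S\<close> by (metis less_irrefl nat_neq_iff)
  qed
  moreover have "(\<lambda>v. g v div ?n) ` S \<subseteq> {..<q}"
    using g_less by (auto intro: less_mult_imp_div_less)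
  ultimately show ?thesis using card_inj_on_le[of _ S "{..<q}"] by fastforce
qed simp

lemma rotation_exists:
  assumes "\<phi> permutes {1..n}"
  obtains \<psi> where "(\<phi>, \<psi>) \<in> rotation_rel n"
    "\<And>i. i \<in> {1..n} \<Longrightarrow> \<phi> i = \<psi> (shift_index n k i)"
proof -
  \<comment> \<open>The inverse shift: \<open>n * k - k\<close> is a natural number congruent to
    \<open>-k\<close> modulo \<open>n\<close>. Fixing everything outside \<open>{1..n}\<close> is
    what \<open>permutes\<close> demands.\<close>
  define \<sigma> where "\<sigma> i = (if i \<in> {1..n} then shift_index n (n * k - k) i else i)" for i
  have eq: "shift_index n k (shift_index n (n * k - k) i) = i"
    "shift_index n (n * k - k) (shift_index n k i) = i" if i: "i \<in> {1..n}" for i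
  proof -
    from i have n: "n > 0" by auto
    then have "n * k - k + k = n * k" "k + (n * k - k) = n * k" by simp_all
    then show "shift_index n k (shift_index n (n * k - k) i) = i"
      "shift_index n (n * k - k) (shift_index n k i) = i"
      using n shift_index_add[OF n] shift_index_multiple[OF i] by simp_all
  qed
  have in_dom: "\<sigma> i = shift_index n (n * k - k) i" if "i \<in> {1..n}" for i
    using that by (simp add: \<sigma>_def)
  have "bij_betw \<sigma> {1..n} {1..n}"
  proof (rule bij_betw_byWitness[where f' = "shift_index n k"])
    show "\<forall>i\<in>{1..n}. shift_index n k (\<sigma> i) = i"
      using eq(1) in_dom by metis
    show "\<forall>i\<in>{1..n}. \<sigma> (shift_index n k i) = i"
      using eq(2) in_dom shift_index_in by metis
    show "\<sigma> ` {1..n} \<subseteq> {1..n}" "shift_index n k ` {1..n} \<subseteq> {1..n}"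
      using in_dom shift_index_in by (metis image_subsetI)+
  qed
  then have \<sigma>: "\<sigma> permutes {1..n}"
    by (rule bij_imp_permutes) (auto simp: \<sigma>_def)
  have shift: "\<phi> i = (\<phi> \<circ> \<sigma>) (shift_index n k i)" if "i \<in> {1..n}" for i
    using in_dom[OF shift_index_in[OF that]] eq(2)[OF that] by (metis comp_apply)
  moreover have "(\<phi>, \<phi> \<circ> \<sigma>) \<in> rotation_rel n"
    using assms permutes_compose[OF \<sigma> assms] shift unfolding rotation_rel_def by blast
  ultimately show thesis using that by blast
qed

text \<open>In a suitable representative the values \<open>1, ..., q\<close> occupy the positions
  \<open>1, r + 1, ..., r * (q - 1) + 1\<close>. The last of these is \<open>n\<close>, so no
  reduction occurs and the order is increasing.\<close>

lemma winding_clique_exists: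
  assumes "q \<ge> 1" "r \<ge> 1"
  shows "is_clique3 (winding_hypergraph q r) {1..q}"
proof -
  let ?n = "winding_size q r"
  have "1 * (q - 1) \<le> r * (q - 1)" using assms by (intro mult_le_mono) auto
  then have "q \<le> ?n" unfolding winding_size_def by linarith
  then have sub: "{1..q} \<subseteq> {1..?n}" by auto
  \<comment> \<open>Rotating by one moves the element 1 from the last position to the first.\<close>
  obtain \<psi> where \<psi>: "(winding_perm q r, \<psi>) \<in> rotation_rel ?n"
    "\<And>i. i \<in> {1..?n} \<Longrightarrow> winding_perm q r i = \<psi> (shift_index ?n 1 i)"
    using rotation_exists[OF winding_perm_permutes[OF assms]] by blast
  have pos: "inv \<psi> v = Suc (r * (v - 1))" if v: "v \<in> {1..q}" for v
  proof -
    have vn: "v \<in> {1..?n}" using v sub by blast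
    have "r * (v - 1) \<le> r * (q - 1)" using v by (intro mult_le_mono) auto
    then have "r * (v - 1) < ?n" unfolding winding_size_def by linarith
    moreover have "?n - 1 + 1 = ?n" by (simp add: winding_size_def)
    ultimately show ?thesis
      using inv_rotation[OF \<psi> vn] shift_inv_winding_perm[OF vn assms, of 1] by simp
  qed
  have mono: "inv \<psi> i < inv \<psi> j" if "i \<in> {1..q}" "j \<in> {1..q}" "i < j" for i j
    using that assms by (auto simp: pos diff_less_mono)
  show ?thesis
    unfolding winding_hypergraph_def
  proof (rule is_clique3_perm_hypergraphI[OF sub])
    fix i j k assume "i \<in> {1..q}" "j \<in> {1..q}" "k \<in> {1..q}" "i < j" "j < k"
    then show "clockwise (cyclic_perm ?n (winding_perm q r)) i j k"
      using mono \<psi>(1) unfolding clockwise_def cyclic_perm_def by blast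
  qed
qed

theorem lemma3:
  fixes q r :: nat
  assumes "q \<ge> 1" and "r \<ge> 1"
  shows "clique_number (winding_hypergraph q r) = q"
  unfolding clique_number_def
proof (rule Max_eqI)
  show "finite {card S |S. is_clique3 (winding_hypergraph q r) S}"
    by (rule finite_subset[of _ "{..q}"]) (use winding_clique_card_le assms in auto)
  show "y \<le> q" if "y \<in> {card S |S. is_clique3 (winding_hypergraph q r) S}" for y
    using that winding_clique_card_le assms by auto
  show "q \<in> {card S |S. is_clique3 (winding_hypergraph q r) S}"
    using winding_clique_exists[OF assms] by (intro CollectI exI[of _ "{1..q}"]) simp
qed

end
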